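(* Let $T$ be a left continuous t-norm on $[0,1]$ and $L$ be a right continuous t-conorm on $[0,\infty]$. Then $L\otimes T(f,g)\in\mathcal{D}^+_0$ for all $f,g\in\mathcal{D}^+_0$ if and only if $T$ is continuous and $L$ satisfies the condition (LS): for all $x,x',y,y'\in[0,\infty]$, if $x<x'$ and $y<y'$ then $L(x,y)<L(x',y')$. In this case, $(\mathcal{D}^+_0,L\otimes T)$ is a submonoid of $(\Delta^+,L\otimes T)$.
   Context: A distance distribution function (d.d.f.) is an increasing (i.e. non-decreasing) function $f:[0,\infty]\to[0,1]$ with $f(0)=0$, $f(\infty)=1$ that is left continuous on the open interval $]0,\infty[$. $\Delta^+$ is the set of all d.d.f.'s, ordered pointwise; it is a complete lattice in which suprema of non-empty families are computed pointwise. $\mathcal{D}^+_0\subseteq\Delta^+$ is the set of all d.d.f.'s that are continuous on $]0,\infty]$ (in particular $\sup_{x<\infty}f(x)=1$). For $r\in[0,\infty]$, $p\in[0,1]$, the step function $\varepsilon(r,p)\in\Delta^+$ is given by $\varepsilon(r,p)(\infty)=1$, $\varepsilon(r,p)(x)=p$ for $r<x<\infty$, and $\varepsilon(r,p)(x)=0$ for $x\le r$, $x<\infty$. A t-norm $T$ is an associative, commutative binary operation on $[0,1]$, increasing in each place, with identity $1$; it is left continuous (resp. continuous) if it is left continuous (resp. continuous) as a function $[0,1]^2\to[0,1]$ (left continuity is equivalent to preserving arbitrary suprema in each variable). A t-conorm $L$ on $[0,\infty]$ is an associative, commutative binary operation on $[0,\infty]$, increasing in each place, with identity $0$; it is right continuous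 if it is right continuous as a function $[0,\infty]^2\to[0,\infty]$ (equivalently, it preserves arbitrary infima in each variable). $L\otimes T$ is the binary operation on $\Delta^+$ that preserves arbitrary suprema in each variable and satisfies $L\otimes T(\varepsilon(r,p),\varepsilon(s,q))=\varepsilon(L(r,s),T(p,q))$ for all $r,s,p,q$; equivalently $L\otimes T(f,g)=\sup_{r,s\in[0,\infty]}\varepsilon(L(r,s),T(f(r),g(s)))$ (supremum in $\Delta^+$). $(\Delta^+,L\otimes T)$ is a commutative monoid with identity $\varepsilon(0,1)$. *)

theory Defs
  imports "HOL-Analysis.Analysis" "HOL-Algebra.Group"
begin

definition ddf :: "(ennreal \<Rightarrow> real) set" where
  "ddf = {f. (\<forall>x. f x \<in> {0..1}) \<and> mono f \<and> f 0 = 0 \<and> f \<infinity> = 1 \<and>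
             (\<forall>x. 0 < x \<and> x < \<infinity> \<longrightarrow> continuous (at_left x) f)}"

text \<open>Continuity is required on the half-open interval from 0 (excluded) to infinity (included);
  a jump at 0 is allowed.\<close>

definition cont_ddf :: "(ennreal \<Rightarrow> real) set" where
  "cont_ddf = {f \<in> ddf. continuous_on {0<..} f}"

definition step_ddf :: "ennreal \<Rightarrow> real \<Rightarrow> ennreal \<Rightarrow> real" where
  "step_ddf r p x = (if x = \<infinity> then 1 else if r < x then p else 0)"

text \<open>A t-norm is a function on all pairs of reals of which only the restriction to the unit square
  matters.\<close>

definition tnorm :: "(real \<Rightarrow> real \<Rightarrow> real) \<Rightarrow> bool" where
  "tnorm T \<longleftrightarrow>
     (\<forall>p\<in>{0..1}. \<forall>q\<in>{0..1}. T p q \<in> {0..1}) \<and>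
     (\<forall>p\<in>{0..1}. \<forall>q\<in>{0..1}. \<forall>u\<in>{0..1}. T (T p q) u = T p (T q u)) \<and>
     (\<forall>p\<in>{0..1}. \<forall>q\<in>{0..1}. T p q = T q p) \<and>
     (\<forall>p\<in>{0..1}. \<forall>p'\<in>{0..1}. \<forall>q\<in>{0..1}. p \<le> p' \<longrightarrow> T p q \<le> T p' q \<and> T q p \<le> T q p') \<and>
     (\<forall>p\<in>{0..1}. T p 1 = p \<and> T 1 p = p)"

text \<open>One-sided continuity of a function of two variables: the limit at a point is taken
  within the closed lower (respectively upper) quadrant with corner at that point.\<close>

definition left_continuous_tnorm :: "(real \<Rightarrow> real \<Rightarrow> real) \<Rightarrow> bool" where
  "left_continuous_tnorm T \<longleftrightarrow>
     (\<forall>a\<in>{0..1}. \<forall>b\<in>{0..1}.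
        ((\<lambda>(p, q). T p q) \<longlongrightarrow> T a b) (at (a, b) within {0..a} \<times> {0..b}))"

definition continuous_tnorm :: "(real \<Rightarrow> real \<Rightarrow> real) \<Rightarrow> bool" where
  "continuous_tnorm T \<longleftrightarrow> continuous_on ({0..1} \<times> {0..1}) (\<lambda>(p, q). T p q)"

definition tconorm :: "(ennreal \<Rightarrow> ennreal \<Rightarrow> ennreal) \<Rightarrow> bool" where
  "tconorm L \<longleftrightarrow>
     (\<forall>x y z. L (L x y) z = L x (L y z)) \<and>
     (\<forall>x y. L x y = L y x) \<and>
     (\<forall>x x' y. x \<le> x' \<longrightarrow> L x y \<le> L x' y \<and> L y x \<le> L y x') \<and>
     (\<forall>x. L x 0 = x \<and> L 0 x = x)"

definition right_continuous_tconorm :: "(ennreal \<Rightarrow> ennreal \<Rightarrow> ennreal) \<Rightarrow> bool" where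
  "right_continuous_tconorm L \<longleftrightarrow>
     (\<forall>a b. ((\<lambda>(x, y). L x y) \<longlongrightarrow> L a b) (at (a, b) within {a..} \<times> {b..}))"

definition LS_condition :: "(ennreal \<Rightarrow> ennreal \<Rightarrow> ennreal) \<Rightarrow> bool" where
  "LS_condition L \<longleftrightarrow> (\<forall>x x' y y'. x < x' \<and> y < y' \<longrightarrow> L x y < L x' y')"

text \<open>Suprema of non-empty families of distance distribution functions are computed pointwise;
  lemma \<open>ddf_tensor_least_upper_bound\<close> below confirms that the pointwise supremum used here
  is the supremum in \<^term>\<open>ddf\<close>.\<close>

definition ddf_tensor ::
  "(ennreal \<Rightarrow> ennreal \<Rightarrow> ennreal) \<Rightarrow> (real \<Rightarrow> real \<Rightarrow> real) \<Rightarrow>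
   (ennreal \<Rightarrow> real) \<Rightarrow> (ennreal \<Rightarrow> real) \<Rightarrow> ennreal \<Rightarrow> real" where
  "ddf_tensor L T f g = (\<lambda>x. SUP (r, s) \<in> UNIV. step_ddf (L r s) (T (f r) (g s)) x)"

definition ddf_monoid ::
  "(ennreal \<Rightarrow> ennreal \<Rightarrow> ennreal) \<Rightarrow> (real \<Rightarrow> real \<Rightarrow> real) \<Rightarrow> (ennreal \<Rightarrow> real) monoid" where
  "ddf_monoid L T = \<lparr>carrier = ddf, mult = ddf_tensor L T, one = step_ddf 0 1\<rparr>"

lemma step_ddf_mem:
  assumes "p \<in> {0..1}"
  shows "step_ddf r p \<in> ddf"
proof -
  have "continuous (at_left x) (step_ddf r p)" if x: "0 < x" "x < \<infinity>" for x
  proof -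
    have "eventually (\<lambda>y. step_ddf r p x = step_ddf r p y) (at_left x)"
    proof (cases "r < x")
      case True
      with x have "eventually (\<lambda>y. y \<in> {r<..<x}) (at_left x)"
        by (intro eventually_at_leftI[of r]) auto
      then show ?thesis
        by eventually_elim (use True x in \<open>auto simp: step_ddf_def\<close>)
    next
      case False
      have "eventually (\<lambda>y. y < x) (at_left x)"
        by (simp add: eventually_at_filter)
      then show ?thesis
        by eventually_elim (use False x in \<open>auto simp: step_ddf_def\<close>)
    qed
    then show ?thesis
      unfolding continuous_within by (rule tendsto_eventually[OF eventually_mono]) simp
  qed
  moreover have "mono (step_ddf r p)"
    using assms by (auto simp: step_ddf_def mono_def top.extremum_unique)
  ultimately show ?thesis
    using assms by (auto simp: ddf_def step_ddf_def)
qed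

context
  fixes T :: "real \<Rightarrow> real \<Rightarrow> real" and L :: "ennreal \<Rightarrow> ennreal \<Rightarrow> ennreal"
  assumes T: "tnorm T" and L: "tconorm L"
begin

lemma step_tensor_mem:
  assumes "f \<in> ddf" "g \<in> ddf"
  shows "step_ddf (L r s) (T (f r) (g s)) \<in> ddf"
  using assms T by (intro step_ddf_mem) (auto simp: ddf_def tnorm_def)

lemma step_tensor_range:
  assumes "f \<in> ddf" "g \<in> ddf"
  shows "step_ddf (L r s) (T (f r) (g s)) x \<in> {0..1}"
  using step_tensor_mem[OF assms] by (auto simp: ddf_def)

lemma bdd_tensor:
  assumes "f \<in> ddf" "g \<in> ddf"
  shows "bdd_above (range (\<lambda>(r, s). step_ddf (L r s) (T (f r) (g s)) x))"
  using step_tensor_range[OF assms] by (intro bdd_aboveI[of _ 1]) auto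

lemma tensor_upper:
  assumes "f \<in> ddf" "g \<in> ddf"
  shows "step_ddf (L r s) (T (f r) (g s)) x \<le> ddf_tensor L T f g x"
  unfolding ddf_tensor_def
  using cSUP_upper[OF _ bdd_tensor[OF assms], of "(r, s)" x] by simp

lemma tensor_least:
  assumes "\<And>r s. step_ddf (L r s) (T (f r) (g s)) x \<le> b"
  shows "ddf_tensor L T f g x \<le> b"
  unfolding ddf_tensor_def using assms by (intro cSUP_least) auto

lemma less_tensor_iff:
  assumes "f \<in> ddf" "g \<in> ddf" "x < \<infinity>" "0 \<le> a"
  shows "a < ddf_tensor L T f g x \<longleftrightarrow> (\<exists>r s. L r s < x \<and> a < T (f r) (g s))"
proof -
  have "a < ddf_tensor L T f g x \<longleftrightarrow> (\<exists>r s. a < step_ddf (L r s) (T (f r) (g s)) x)"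
    unfolding ddf_tensor_def using less_cSUP_iff[OF _ bdd_tensor[OF assms(1,2)], of a x] by auto
  also have "\<dots> \<longleftrightarrow> (\<exists>r s. L r s < x \<and> a < T (f r) (g s))"
    using assms(3,4) by (auto simp: step_ddf_def)
  finally show ?thesis .
qed

lemma tensor_nonneg:
  assumes "f \<in> ddf" "g \<in> ddf"
  shows "0 \<le> ddf_tensor L T f g x"
  using step_tensor_range[OF assms, of 0 0 x] tensor_upper[OF assms, of 0 0 x] by simp

lemma ddf_tensor_closed:
  assumes f: "f \<in> ddf" and g: "g \<in> ddf"
  shows "ddf_tensor L T f g \<in> ddf"
proof -
  let ?h = "ddf_tensor L T f g"
  have range: "?h x \<in> {0..1}" for x
    using tensor_nonneg[OF f g] tensor_least[of f g x 1] step_tensor_range[OF f g] by auto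
  have mono: "mono ?h"
  proof (rule monoI)
    fix x y :: ennreal assume "x \<le> y"
    show "?h x \<le> ?h y"
    proof (rule tensor_least)
      fix r s
      have "step_ddf (L r s) (T (f r) (g s)) x \<le> step_ddf (L r s) (T (f r) (g s)) y"
        using step_tensor_mem[OF f g] \<open>x \<le> y\<close> by (auto simp: ddf_def mono_def)
      then show "step_ddf (L r s) (T (f r) (g s)) x \<le> ?h y"
        using tensor_upper[OF f g] by (rule order_trans)
    qed
  qed
  have "?h 0 = 0"
    using tensor_nonneg[OF f g, of 0] less_tensor_iff[OF f g, of 0 0] by force
  moreover have "?h \<infinity> = 1"
    by (simp add: ddf_tensor_def step_ddf_def case_prod_unfold)
  moreover have "continuous (at_left x) ?h" if x: "0 < x" "x < \<infinity>" for x
    unfolding continuous_within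
  proof (rule order_tendstoI)
    fix a assume a: "a < ?h x"
    show "eventually (\<lambda>y. a < ?h y) (at_left x)"
    proof (cases "a < 0")
      case True
      then show ?thesis
        using tensor_nonneg[OF f g] by (intro always_eventually) (auto intro: less_le_trans)
    next
      case False
      then obtain r s where rs: "L r s < x" "a < T (f r) (g s)"
        using a x less_tensor_iff[OF f g, of x a] by auto
      have "eventually (\<lambda>y. y \<in> {L r s<..<x}) (at_left x)"
        by (rule eventually_at_leftI[OF _ rs(1)])
      then show ?thesis
      proof eventually_elim
        case (elim y)
        then have "y < \<infinity>" "L r s < y"
          using x by (auto intro: less_trans)
        then show ?case
          using False rs(2) less_tensor_iff[OF f g, of y a] by auto
      qed
    qed
  next
    fix a assume a: "?h x < a"
    have "eventually (\<lambda>y. y < x) (at_left x)"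
      by (simp add: eventually_at_filter)
    then show "eventually (\<lambda>y. ?h y < a) (at_left x)"
      by eventually_elim (use a mono in \<open>auto simp: mono_def intro: le_less_trans less_imp_le\<close>)
  qed
  ultimately show ?thesis
    using range mono by (simp add: ddf_def)
qed

lemma ddf_tensor_least_upper_bound:
  assumes "f \<in> ddf" "g \<in> ddf"
  shows "ddf_tensor L T f g \<in> ddf"
    and "\<And>r s. step_ddf (L r s) (T (f r) (g s)) \<le> ddf_tensor L T f g"
    and "\<And>h. h \<in> ddf \<Longrightarrow> (\<And>r s. step_ddf (L r s) (T (f r) (g s)) \<le> h) \<Longrightarrow> ddf_tensor L T f g \<le> h"
  using ddf_tensor_closed[OF assms] tensor_upper[OF assms] tensor_least[of f g]
  by (auto simp: le_fun_def)

end

lemma tnorm_left_approx: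
  assumes T: "tnorm T" "left_continuous_tnorm T"
    and u: "u \<in> {0..1}" "v \<in> {0..1}" "0 \<le> a" "a < T u v"
  obtains u' where "0 \<le> u'" "u' < u" "a < T u' v"
proof -
  have "T 0 v \<le> T 0 1"
    using T(1) u(2) unfolding tnorm_def
    by (metis atLeastAtMost_iff order_refl zero_le_one)
  then have "T 0 v \<le> 0"
    using T(1) unfolding tnorm_def by simp
  then have "u \<noteq> 0"
    using u by auto
  then have ev: "eventually (\<lambda>p. p \<in> {0<..<u}) (at_left u)"
    using u by (intro eventually_at_left_real) auto
  have "filterlim (\<lambda>p. (p, v)) (at (u, v) within {0..u} \<times> {0..v}) (at_left u)"
    unfolding filterlim_at
  proof
    show "\<forall>\<^sub>F p in at_left u. (p, v) \<in> {0..u} \<times> {0..v} \<and> (p, v) \<noteq> (u, v)"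
      using ev by eventually_elim (use u in auto)
    show "((\<lambda>p. (p, v)) \<longlongrightarrow> (u, v)) (at_left u)"
      by (intro tendsto_intros)
  qed
  then have "((\<lambda>p. T p v) \<longlongrightarrow> T u v) (at_left u)"
    using T(2) u filterlim_compose[of "\<lambda>(p, q). T p q"]
    unfolding left_continuous_tnorm_def by fastforce
  then have "eventually (\<lambda>p. a < T p v) (at_left u)"
    using u(4) by (rule order_tendstoD)
  with ev have "eventually (\<lambda>p. 0 \<le> p \<and> p < u \<and> a < T p v) (at_left u)"
    by eventually_elim auto
  then show ?thesis
    using that eventually_happens[of _ "at_left u"] by auto
qed

lemma tconorm_right_approx:
  assumes L: "tconorm L" "right_continuous_tconorm L" and x: "L r s < x"
  obtains r' where "r < r'" "r' < \<infinity>" "L r' s < x"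
proof -
  have "L r 0 \<le> L r s" "L r 0 = r"
    using L(1) zero_le[of s] unfolding tconorm_def by blast+
  then have "r \<le> L r s"
    by simp
  then have "r < \<infinity>"
    using x by (auto simp: less_top[symmetric] top_unique)
  then have r: "r < \<infinity>" by simp
  have ev: "eventually (\<lambda>p. p \<in> {r<..<\<infinity>}) (at_right r)"
    by (rule eventually_at_rightI[OF _ r])
  have "filterlim (\<lambda>p. (p, s)) (at (r, s) within {r..} \<times> {s..}) (at_right r)"
    unfolding filterlim_at
  proof
    show "\<forall>\<^sub>F p in at_right r. (p, s) \<in> {r..} \<times> {s..} \<and> (p, s) \<noteq> (r, s)"
      using ev by eventually_elim auto
    show "((\<lambda>p. (p, s)) \<longlongrightarrow> (r, s)) (at_right r)"
      by (intro tendsto_intros)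
  qed
  then have "((\<lambda>p. L p s) \<longlongrightarrow> L r s) (at_right r)"
    using L(2) filterlim_compose[of "\<lambda>(p, q). L p q"]
    unfolding right_continuous_tconorm_def by fastforce
  then have "eventually (\<lambda>p. L p s < x) (at_right r)"
    using x by (rule order_tendstoD)
  with ev have "eventually (\<lambda>p. r < p \<and> p < \<infinity> \<and> L p s < x) (at_right r)"
    by eventually_elim auto
  moreover have "at_right r \<noteq> bot"
    using dense by (auto simp: eventually_at_right[OF r] eventually_False[symmetric])
  ultimately show ?thesis
    using that eventually_happens[of _ "at_right r"] by (auto simp: trivial_limit_def)
qed

lemma ddf_eqI:
  assumes "f \<in> ddf" "g \<in> ddf"
    and "\<And>x a. x < \<infinity> \<Longrightarrow> 0 \<le> a \<Longrightarrow> a < f x \<longleftrightarrow> a < g x"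
  shows "f = g"
proof
  fix x
  have 0: "0 \<le> f x" "0 \<le> g x" "f \<infinity> = g \<infinity>"
    using assms(1,2) by (auto simp: ddf_def)
  show "f x = g x"
  proof (cases "x = \<infinity>")
    case False
    then show ?thesis
      using 0 assms(3)[of x "f x"] assms(3)[of x "g x"] by (force simp: less_top)
  qed (use 0 in simp)
qed

theorem comm_monoid_ddf_monoid:
  assumes T: "tnorm T" "left_continuous_tnorm T"
    and L: "tconorm L" "right_continuous_tconorm L"
  shows "comm_monoid (ddf_monoid L T)"
proof -
  note closed = ddf_tensor_closed[OF T(1) L(1)]
  note iff = less_tensor_iff[OF T(1) L(1)]
  have T_mem: "T p q \<in> {0..1}" and T_assoc: "T (T p q) u = T p (T q u)" and T_comm: "T p q = T q p"
    and T_one: "T 1 p = p"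
    if "p \<in> {0..1}" "q \<in> {0..1}" "u \<in> {0..1}" for p q u
    using T(1) that unfolding tnorm_def by blast+
  have T_mono: "T p q \<le> T p' q" if "p \<in> {0..1}" "p' \<in> {0..1}" "q \<in> {0..1}" "p \<le> p'" for p p' q
    using T(1) that unfolding tnorm_def by blast
  have L_assoc: "L (L x y) z = L x (L y z)" and L_comm: "L x y = L y x" and L_zero: "L 0 x = x" for x y z
    using L(1) unfolding tconorm_def by blast+
  have L_mono: "L x y \<le> L x' y" if "x \<le> x'" for x x' y
    using L(1) that unfolding tconorm_def by blast
  have range: "f x \<in> {0..1}" if "f \<in> ddf" for f x
    using that by (auto simp: ddf_def)
  have one: "step_ddf 0 1 \<in> ddf"
    by (rule step_ddf_mem) simp
  have comm: "ddf_tensor L T f g = ddf_tensor L T g f" if f: "f \<in> ddf" and g: "g \<in> ddf" for f g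
  proof -
    have "(\<exists>r s. L r s < x \<and> a < T (f r) (g s)) \<longleftrightarrow> (\<exists>s r. L s r < x \<and> a < T (g s) (f r))" for x a
      using L_comm T_comm[OF range[OF f] range[OF g] range[OF f]]
      by (subst ex_comm) (intro ex_cong1, simp)
    then show ?thesis
      by (intro ddf_eqI closed f g) (simp add: iff f g)
  qed
  have triple: "a < ddf_tensor L T (ddf_tensor L T f g) h x \<longleftrightarrow>
      (\<exists>r s t. L (L r s) t < x \<and> a < T (T (f r) (g s)) (h t))"
    if f: "f \<in> ddf" and g: "g \<in> ddf" and h: "h \<in> ddf" and x: "x < \<infinity>" and a: "0 \<le> a" for f g h x a
  proof
    assume "a < ddf_tensor L T (ddf_tensor L T f g) h x"
    then obtain u t where ut: "L u t < x" "a < T (ddf_tensor L T f g u) (h t)"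
      using iff closed f g h x a by auto
    then obtain p where p: "0 \<le> p" "p < ddf_tensor L T f g u" "a < T p (h t)"
      using tnorm_left_approx[OF T range[OF closed[OF f g]] range[OF h] a] by blast
    have "L u 0 \<le> L u t"
      using L_mono[of 0 t u] L_comm[of u] by simp
    then have "u \<le> L u t"
      using L_comm[of u 0] L_zero[of u] by simp
    then have "u < \<infinity>"
      using ut(1) x by (meson le_less_trans less_trans)
    then obtain r s where rs: "L r s < u" "p < T (f r) (g s)"
      using iff f g p by auto
    have "p \<in> {0..1}"
      using p rs T_mem[OF range[OF f] range[OF g] range[OF f], of r s] by force
    then have "T p (h t) \<le> T (T (f r) (g s)) (h t)"
      using T_mem[OF range[OF f] range[OF g] range[OF f], of r s] rs(2) range[OF h]
      by (intro T_mono) auto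
    moreover have "L (L r s) t \<le> L u t"
      using rs(1) by (intro L_mono) auto
    ultimately show "\<exists>r s t. L (L r s) t < x \<and> a < T (T (f r) (g s)) (h t)"
      using ut p by (meson le_less_trans less_le_trans)
  next
    assume "\<exists>r s t. L (L r s) t < x \<and> a < T (T (f r) (g s)) (h t)"
    then obtain r s t where rst: "L (L r s) t < x" "a < T (T (f r) (g s)) (h t)"
      by blast
    obtain u where u: "L r s < u" "u < \<infinity>" "L u t < x"
      using tconorm_right_approx[OF L rst(1)] by blast
    have "T (f r) (g s) \<le> ddf_tensor L T f g u"
      using tensor_upper[OF T(1) L(1) f g, of r s u] u by (simp add: step_ddf_def less_imp_neq)
    then have "T (T (f r) (g s)) (h t) \<le> T (ddf_tensor L T f g u) (h t)"
      using T_mem[OF range[OF f] range[OF g] range[OF f], of r s]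
      using range[OF closed[OF f g]] range[OF h] by (intro T_mono) auto
    then show "a < ddf_tensor L T (ddf_tensor L T f g) h x"
      using iff[OF closed[OF f g] h x a] u(3) rst(2) less_le_trans by blast
  qed
  have assoc: "ddf_tensor L T (ddf_tensor L T f g) h = ddf_tensor L T f (ddf_tensor L T g h)"
    if f: "f \<in> ddf" and g: "g \<in> ddf" and h: "h \<in> ddf" for f g h
  proof (rule ddf_eqI)
    fix x :: ennreal and a :: real assume xa: "x < \<infinity>" "0 \<le> a"
    have T_rot: "T (T (f r) (g s)) (h t) = T (T (g s) (h t)) (f r)" for r s t
      using T_assoc[OF range[OF f] range[OF g] range[OF h]]
        T_comm[OF range[OF f] T_mem[OF range[OF g] range[OF h] range[OF h]] range[OF f]] by simp
    have L_rot: "L (L r s) t = L (L s t) r" for r s t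
      using L_assoc[of r s t] L_comm[of r "L s t"] by simp
    have "L (L r s) t < x \<and> a < T (T (f r) (g s)) (h t) \<longleftrightarrow>
        L (L s t) r < x \<and> a < T (T (g s) (h t)) (f r)" for r s t
      by (simp only: L_rot[of r s t] T_rot[of r s t])
    then have "(\<exists>r s t. L (L r s) t < x \<and> a < T (T (f r) (g s)) (h t)) \<longleftrightarrow>
        (\<exists>s t r. L (L s t) r < x \<and> a < T (T (g s) (h t)) (f r))"
      by blast
    then show "a < ddf_tensor L T (ddf_tensor L T f g) h x \<longleftrightarrow>
        a < ddf_tensor L T f (ddf_tensor L T g h) x"
      using triple f g h xa comm[OF f closed[OF g h]] by simp
  qed (intro closed f g h)+
  have unit: "ddf_tensor L T (step_ddf 0 1) f = f" if f: "f \<in> ddf" for f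
  proof (rule ddf_eqI)
    fix x :: ennreal and a :: real assume x: "x < \<infinity>" and a: "0 \<le> a"
    have mono: "mono f" and f0: "f 0 = 0"
      using f by (auto simp: ddf_def)
    have T_one': "T 1 (f s) = f s" for s
      using T_one[OF range[OF f] range[OF f] range[OF f]] .
    show "a < ddf_tensor L T (step_ddf 0 1) f x \<longleftrightarrow> a < f x"
    proof
      assume "a < ddf_tensor L T (step_ddf 0 1) f x"
      then obtain r s where rs: "L r s < x" "a < T (step_ddf 0 1 r) (f s)"
        using iff[OF one f x a] by blast
      have "T (step_ddf 0 1 r) (f s) \<le> T 1 (f s)"
        using range[OF one] range[OF f] by (intro T_mono) auto
      moreover have "L 0 s \<le> L r s"
        by (intro L_mono) simp
      then have "f s \<le> f x"
        using rs(1) L_zero[of s] by (intro monoD[OF mono]) auto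
      ultimately show "a < f x"
        using rs(2) T_one'[of s] by linarith
    next
      assume ax: "a < f x"
      then have "0 < x"
        using a f0 by (cases "x = 0") (auto simp: zero_less_iff_neq_zero)
      then have "(f \<longlongrightarrow> f x) (at_left x)"
        using f x by (auto simp: ddf_def continuous_within)
      then have "eventually (\<lambda>y. a < f y) (at_left x)"
        using ax by (rule order_tendstoD)
      then obtain b where b: "b < x" "\<And>y. b < y \<Longrightarrow> y < x \<Longrightarrow> a < f y"
        by (auto simp: eventually_at_left[OF \<open>0 < x\<close>])
      obtain s where s: "s < x" "a < f s"
        using b dense[OF b(1)] by blast
      then have "L 0 s < x"
        using L_zero by simp
      then obtain r where r: "0 < r" "r < \<infinity>" "L r s < x"
        using tconorm_right_approx[OF L] by blast
      then have "a < T (step_ddf 0 1 r) (f s)"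
        using s T_one' by (simp add: step_ddf_def)
      then show "a < ddf_tensor L T (step_ddf 0 1) f x"
        using iff[OF one f x a] r by blast
    qed
  qed (intro closed one f)+
  show ?thesis
    by (rule comm_monoidI) (simp_all add: ddf_monoid_def closed one assoc unit, rule comm)
qed

end

theory Submission
  imports Defs
begin

text \<open>
  At a positive finite argument \<open>x\<close> the tensor \<open>h = ddf_tensor L T f g\<close> is the supremum of \<open>T (f r) (g s)\<close>
  over all \<open>r\<close>, \<open>s\<close> with \<open>L r s < x\<close>, and a jump of \<open>h\<close> has only two possible sources.

  A jump of \<open>T\<close> produces one: if \<open>g\<close> is constantly \<open>q\<close> on a long initial stretch, then there
  \<open>h x = T (f x) q\<close>, so letting \<open>f\<close> grow continuously through a level \<open>p\<close> at which \<open>T _ q\<close>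
  jumps makes \<open>h\<close> jump (\<open>closed_imp_continuous_tnorm\<close>). A failure of (LS) also produces one: if
  \<open>L\<close> takes the same value \<open>z\<close> at the lower left and upper right corners of a rectangle, let \<open>f\<close> and
  \<open>g\<close> rise from 0 to 1 within the two sides. Then \<open>h\<close> vanishes up to \<open>z\<close> and equals 1
  after it (\<open>closed_imp_LS_condition\<close>).

  Conversely, let \<open>T\<close> be continuous and \<open>L\<close> satisfy (LS), and suppose that \<open>h\<close> exceeds a
  level \<open>b\<close> immediately to the right of \<open>x\<close>. This gives points \<open>(r n, s n)\<close> with
  \<open>b < T (f (r n)) (g (s n))\<close> and \<open>L (r n) (s n)\<close> below a sequence decreasing to \<open>x\<close>. By
  compactness of the extended half-line a subsequence converges to some \<open>(r0, s0)\<close>, and by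
  continuity \<open>T (f r0) (g s0)\<close> is at least \<open>b\<close>. Right continuity of \<open>L\<close> does not bound
  \<open>L r0 s0\<close> by \<open>x\<close>, but it need not: (LS) gives \<open>L r' s' < x\<close> for all \<open>r'\<close>, \<open>s'\<close>
  strictly below \<open>r0\<close>, \<open>s0\<close> (\<open>LS_limit_less\<close>), and the left continuity of \<open>T\<close>, \<open>f\<close>
  and \<open>g\<close> lets \<open>T (f r') (g s')\<close> exceed any level below \<open>b\<close>. So \<open>h x\<close> is at least
  \<open>b\<close> (\<open>ddf_tensor_mem_cont_ddf\<close>). Jumps of \<open>f\<close> and \<open>g\<close> at 0 are harmless: the values at 0
  are replaced by the right limits (\<open>cont_ddf_extension\<close>), and the right continuity of \<open>L\<close>
  allows moving from 0 to a nearby positive argument.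
\<close>

section \<open>Continuous distance distribution functions\<close>

text \<open>Monotonicity and left continuity leave only two ways to be discontinuous: a jump on the
  right of a finite positive point, and a mass at infinity.\<close>

lemma cont_ddf_iff:
  assumes f: "f \<in> ddf"
  shows "f \<in> cont_ddf \<longleftrightarrow>
    (\<forall>x a. 0 < x \<longrightarrow> x < \<infinity> \<longrightarrow> f x < a \<longrightarrow> (\<exists>y>x. f y < a)) \<and>
    (\<forall>a<1. \<exists>y<\<infinity>. a < f y)"
proof
  assume "f \<in> cont_ddf"
  then have cont: "isCont f x" if "0 < x" for x
    using that by (auto simp: cont_ddf_def continuous_on_eq_continuous_at)
  have "\<exists>y>x. f y < a" if x: "0 < x" "x < \<infinity>" and a: "f x < a" for x a
  proof -
    have "eventually (\<lambda>y. f y < a) (at_right x)"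
      using filterlim_mono[OF cont[OF x(1), unfolded isCont_def] order_refl at_le[OF subset_UNIV]] a
      by (rule order_tendstoD(2))
    then obtain b where "x < b" "\<And>y. x < y \<Longrightarrow> y < b \<Longrightarrow> f y < a"
      by (auto simp: eventually_at_right[OF x(2)])
    then show ?thesis
      using dense by blast
  qed
  moreover have "\<exists>y<\<infinity>. a < f y" if "a < 1" for a
  proof -
    have "eventually (\<lambda>y. a < f y) (at_left \<infinity>)"
      using filterlim_mono[OF cont[of \<infinity>, unfolded isCont_def] order_refl at_le[OF subset_UNIV]]
      by (rule order_tendstoD(1)) (use f that in \<open>auto simp: ddf_def\<close>)
    then obtain b :: ennreal where "b < \<infinity>" "\<And>y. b < y \<Longrightarrow> y < \<infinity> \<Longrightarrow> a < f y"
      using eventually_at_left[of 0 "\<infinity>::ennreal"] by auto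
    then show ?thesis
      using dense by blast
  qed
  ultimately show "(\<forall>x a. 0 < x \<longrightarrow> x < \<infinity> \<longrightarrow> f x < a \<longrightarrow> (\<exists>y>x. f y < a)) \<and> (\<forall>a<1. \<exists>y<\<infinity>. a < f y)"
    by blast
next
  assume "(\<forall>x a. 0 < x \<longrightarrow> x < \<infinity> \<longrightarrow> f x < a \<longrightarrow> (\<exists>y>x. f y < a)) \<and> (\<forall>a<1. \<exists>y<\<infinity>. a < f y)"
  then have right: "\<And>x a. 0 < x \<Longrightarrow> x < \<infinity> \<Longrightarrow> f x < a \<Longrightarrow> \<exists>y>x. f y < a"
    and inf: "\<And>a. a < 1 \<Longrightarrow> \<exists>y<\<infinity>. a < f y"
    by blast+
  have mono: "f x \<le> f y" if "x \<le> y" for x y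
    using f that by (auto simp: ddf_def mono_def)
  have "isCont f x" if x: "0 < x" for x
    unfolding isCont_def
  proof (rule order_tendstoI)
    fix a assume a: "f x < a"
    show "eventually (\<lambda>y. f y < a) (at x)"
    proof (cases "x = \<infinity>")
      case True
      then show ?thesis
        using a le_less_trans[OF mono[of _ x]] by (intro always_eventually) simp
    next
      case False
      then obtain z where z: "x < z" "f z < a"
        using right[of x a] x a by (auto simp: less_top)
      have "eventually (\<lambda>y. y < z) (at x)"
        using order_tendstoD(2)[OF tendsto_ident_at z(1)] .
      then show ?thesis
        by eventually_elim (use z mono in \<open>blast intro: le_less_trans less_imp_le\<close>)
    qed
  next
    fix a assume a: "a < f x"
    have "\<exists>z<x. a < f z"
    proof (cases "x = \<infinity>")
      case True
      then show ?thesis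
        using inf[of a] a f by (auto simp: ddf_def)
    next
      case False
      then have "(f \<longlongrightarrow> f x) (at_left x)"
        using f x by (auto simp: ddf_def continuous_within less_top)
      then have "eventually (\<lambda>y. a < f y) (at_left x)"
        using a by (rule order_tendstoD)
      then obtain b where "b < x" "\<And>y. b < y \<Longrightarrow> y < x \<Longrightarrow> a < f y"
        by (auto simp: eventually_at_left[OF x])
      then show ?thesis
        using dense by blast
    qed
    then obtain z where z: "z < x" "a < f z"
      by blast
    have "eventually (\<lambda>y. z < y) (at x)"
      using order_tendstoD(1)[OF tendsto_ident_at z(1)] .
    then show "eventually (\<lambda>y. a < f y) (at x)"
      by eventually_elim (use z mono in \<open>blast intro: less_le_trans less_imp_le\<close>)
  qed
  then show "f \<in> cont_ddf"
    using f by (auto simp: cont_ddf_def continuous_on_eq_continuous_at)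
qed

text \<open>Replacing the value at 0 by the right limit there removes the only permitted jump and gives
  a function that is continuous on a compact space, as the compactness argument for sufficiency
  requires.\<close>

lemma cont_ddf_extension:
  assumes f: "f \<in> cont_ddf"
  obtains F where "continuous_on UNIV F" "mono F" "\<And>x. F x \<in> {0..1}"
    "\<And>x. 0 < x \<Longrightarrow> F x = f x" "\<And>x. f x \<le> F x"
proof
  define F where "F x = (if x = 0 then INF t\<in>{0<..}. f t else f x)" for x
  have f': "f \<in> ddf" "continuous_on {0<..} f"
    using f by (auto simp: cont_ddf_def)
  have mono_f: "f x \<le> f y" if "x \<le> y" for x y
    using f' that by (auto simp: ddf_def mono_def)
  have range_f: "0 \<le> f x" "f x \<le> 1" for x
    using f' by (auto simp: ddf_def)
  have ne: "{0::ennreal<..} \<noteq> {}"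
    using zero_less_one by blast
  have bdd: "bdd_below (f ` {0<..})"
    using range_f by (intro bdd_belowI[of _ 0]) auto
  have F0: "F 0 \<le> f t" if "0 < t" for t
    using that by (auto simp: F_def intro!: cINF_lower[OF bdd])
  show pos: "F x = f x" if "0 < x" for x
    using that by (simp add: F_def zero_less_iff_neq_zero)
  have F0_nonneg: "0 \<le> F 0"
    unfolding F_def using range_f ne by (auto intro!: cINF_greatest)
  show mono_F: "mono F"
    by (rule monoI) (use F0 mono_f pos in \<open>metis order_refl zero_less_iff_neq_zero less_le_trans\<close>)
  show "f x \<le> F x" for x
    using F0_nonneg f' pos by (cases "x = 0") (auto simp: ddf_def zero_less_iff_neq_zero)
  show "F x \<in> {0..1}" for x
    using F0_nonneg F0[of 1] range_f[of 1] range_f[of x] pos[of x]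
    by (cases "x = 0") (auto simp: zero_less_iff_neq_zero)
  have "isCont F x" for x
  proof (cases "x = 0")
    case True
    show ?thesis
      unfolding isCont_def True
    proof (rule order_tendstoI)
      fix a assume "a < F 0"
      then show "eventually (\<lambda>y. a < F y) (at 0)"
        using mono_F by (intro always_eventually allI) (auto simp: mono_def intro: less_le_trans)
    next
      fix a assume "F 0 < a"
      then obtain t where t: "0 < t" "f t < a"
        using cINF_less_iff[OF ne bdd] by (auto simp: F_def)
      have "eventually (\<lambda>y. y < t) (at 0)"
        using order_tendstoD(2)[OF tendsto_ident_at t(1)] .
      then show "eventually (\<lambda>y. F y < a) (at 0)"
        by eventually_elim
          (use t mono_F pos in \<open>metis le_less_trans less_imp_le monoD\<close>)
    qed
  next
    case False
    have "continuous_on {0<..} F"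
      using f'(2) by (rule continuous_on_eq) (simp add: pos)
    then show ?thesis
      using False by (simp add: continuous_on_eq_continuous_at zero_less_iff_neq_zero)
  qed
  then show "continuous_on UNIV F"
    by (simp add: continuous_on_eq_continuous_at)
qed

text \<open>After a jump to \<open>p\<close> at 0 the function stays at \<open>p\<close> up to \<open>x\<close>, then rises linearly and
  reaches 1 at \<open>x + d\<close>. These functions serve as test functions for necessity. Truncated
  subtraction and the minimum with a finite \<open>d\<close> keep the formula uniform up to infinity.\<close>

definition ramp :: "real \<Rightarrow> ennreal \<Rightarrow> ennreal \<Rightarrow> ennreal \<Rightarrow> real" where
  "ramp p x d r = (if r = 0 then 0 else p + (1 - p) * (enn2real (min d (r - x)) / enn2real d))"

lemma ramp_bounds:
  assumes "0 < d" "d < \<infinity>"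
  shows "enn2real (min d u) / enn2real d \<in> {0..1}"
  using assms enn2real_mono[of "min d u" d] by (auto simp: enn2real_positive_iff divide_le_eq_1)

lemma ramp_before:
  assumes "r \<le> x" "x < \<infinity>" "r \<noteq> 0"
  shows "ramp p x d r = p"
proof -
  have "r - x = 0"
    using assms by (intro diff_eq_0_ennreal) auto
  then show ?thesis
    using assms(3) by (simp add: ramp_def)
qed

lemma ramp_le:
  assumes "r \<le> x" "x < \<infinity>" "0 \<le> p"
  shows "ramp p x d r \<le> p"
proof (cases "r = 0")
  case True
  then show ?thesis
    using assms(3) by (simp add: ramp_def)
next
  case False
  then show ?thesis
    using ramp_before[OF assms(1,2)] by simp
qed

lemma ramp_after:
  assumes "0 < d" "d < \<infinity>" "x < \<infinity>" "x + d \<le> r"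
  shows "ramp p x d r = 1"
proof -
  have "d \<le> r - x"
    using assms ennreal_minus_mono[OF assms(4) order_refl, of x] by (simp add: less_top)
  moreover have "r \<noteq> 0"
    using assms by auto
  moreover have "enn2real d \<noteq> 0"
    using assms by (simp add: enn2real_eq_0_iff less_top)
  ultimately show ?thesis
    by (simp add: ramp_def min_absorb1)
qed

lemma ramp_greater:
  assumes "0 < d" "d < \<infinity>" "x < r" "p < 1"
  shows "p < ramp p x d r"
proof -
  have "0 < min d (r - x)" "min d (r - x) < \<infinity>"
    using assms by (auto simp: diff_gr0_ennreal min_less_iff_disj)
  then have "0 < (1 - p) * (enn2real (min d (r - x)) / enn2real d)"
    using assms by (intro mult_pos_pos divide_pos_pos) (auto simp: enn2real_positive_iff)
  moreover have "r \<noteq> 0"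
    using assms by auto
  ultimately show ?thesis
    by (simp add: ramp_def)
qed

lemma ramp_mem_cont_ddf:
  assumes p: "p \<in> {0..1}" and d: "0 < d" "d < \<infinity>" and x: "x < \<infinity>"
  shows "ramp p x d \<in> cont_ddf"
proof -
  define u where "u r = enn2real (min d (r - x)) / enn2real d" for r
  have ramp: "ramp p x d r = (if r = 0 then 0 else p + (1 - p) * u r)" for r
    by (simp add: ramp_def u_def)
  have u: "0 \<le> u r" "u r \<le> 1" for r
    using ramp_bounds[OF d] by (auto simp: u_def)
  have u_mono: "u r \<le> u s" if "r \<le> s" for r s
    unfolding u_def using that d
    by (intro divide_right_mono enn2real_mono min.mono ennreal_minus_mono)
       (auto simp: min_less_iff_disj)
  have range: "ramp p x d r \<in> {0..1}" for r
  proof -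
    have "(1 - p) * u r \<le> (1 - p) * 1"
      using p u by (intro mult_left_mono) auto
    moreover have "0 \<le> (1 - p) * u r"
      using p u by auto
    ultimately have "0 \<le> p + (1 - p) * u r \<and> p + (1 - p) * u r \<le> 1"
      using p by auto
    then show ?thesis
      by (simp add: ramp)
  qed
  have mono: "mono (ramp p x d)"
  proof (rule monoI)
    fix r s :: ennreal assume rs: "r \<le> s"
    show "ramp p x d r \<le> ramp p x d s"
    proof (cases "r = 0")
      case True
      then show ?thesis
        using range[of s] by (simp add: ramp)
    next
      case False
      then have "s \<noteq> 0"
        using rs by auto
      then show ?thesis
        using False rs p u_mono[OF rs] by (simp add: ramp mult_left_mono)
    qed
  qed
  have tendsto_u: "(u \<longlongrightarrow> u r) (at r within S)" for r S
  proof -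
    have "((\<lambda>r. min d (r - x)) \<longlongrightarrow> min d (r - x)) (at r within S)"
      using x by (intro tendsto_min tendsto_diff_ennreal_general tendsto_intros) (use x in auto)
    moreover have "ennreal (enn2real (min d (r - x))) = min d (r - x)"
      using le_less_trans[OF min.cobounded1 d(2)] by simp
    ultimately show ?thesis
      unfolding u_def using d
      by (intro tendsto_divide tendsto_const tendsto_enn2real) (auto simp: enn2real_eq_0_iff)
  qed
  have cont: "continuous_on {0<..} (ramp p x d)"
  proof (rule continuous_on_eq)
    show "continuous_on {0<..} (\<lambda>r. p + (1 - p) * u r)"
      by (intro continuous_intros) (simp add: continuous_on_def tendsto_u)
  qed (auto simp: ramp)
  have "continuous (at_left r) (ramp p x d)" if "0 < r" for r
    using cont that continuous_at_imp_continuous_at_within[of r "ramp p x d" "{..<r}"]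
    by (auto simp: continuous_on_eq_continuous_at)
  moreover have "ramp p x d \<infinity> = 1"
    using d x by (intro ramp_after) auto
  moreover have "ramp p x d 0 = 0"
    by (simp add: ramp)
  ultimately show ?thesis
    using range mono cont by (simp add: cont_ddf_def ddf_def)
qed

lemma one_mem_cont_ddf: "step_ddf 0 1 \<in> cont_ddf"
proof -
  have "step_ddf 0 1 \<in> ddf"
    by (rule step_ddf_mem) simp
  then show ?thesis
  proof (subst cont_ddf_iff, safe)
    fix x :: ennreal and a :: real
    assume "0 < x" "x < \<infinity>" "step_ddf 0 1 x < a"
    then show "\<exists>y>x. step_ddf 0 1 y < a"
      by (intro exI[of _ \<infinity>]) (auto simp: step_ddf_def split: if_splits)
  next
    fix a :: real assume "a < 1"
    then show "\<exists>y<\<infinity>. a < step_ddf 0 1 y"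
      by (intro exI[of _ 1]) (auto simp: step_ddf_def)
  qed
qed

section \<open>Continuity of t-norms\<close>

context
  fixes T :: "real \<Rightarrow> real \<Rightarrow> real"
  assumes T: "tnorm T"
begin

lemma tnorm_range: "p \<in> {0..1} \<Longrightarrow> q \<in> {0..1} \<Longrightarrow> T p q \<in> {0..1}"
  using T unfolding tnorm_def by blast

lemma tnorm_commute: "p \<in> {0..1} \<Longrightarrow> q \<in> {0..1} \<Longrightarrow> T p q = T q p"
  using T unfolding tnorm_def by blast

lemma tnorm_mono:
  assumes "0 \<le> p" "p \<le> p'" "p' \<le> 1" "0 \<le> q" "q \<le> q'" "q' \<le> 1"
  shows "T p q \<le> T p' q'"
proof -
  have "p \<in> {0..1}" "p' \<in> {0..1}" "q \<in> {0..1}" "q' \<in> {0..1}"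
    using assms by auto
  then have "T p q \<le> T p' q" "T p' q \<le> T p' q'"
    using T assms(2,5) unfolding tnorm_def by blast+
  then show ?thesis
    by simp
qed

lemma tnorm_one: "p \<in> {0..1} \<Longrightarrow> T p 1 = p \<and> T 1 p = p"
  using T unfolding tnorm_def by blast

lemma tnorm_zero: "p \<in> {0..1} \<Longrightarrow> T p 0 = 0 \<and> T 0 p = 0"
  using tnorm_one[of 0] tnorm_range[of p 0] tnorm_mono[of p 1 0 0] tnorm_commute[of 0 p] by auto

lemma tnorm_left_approx_both:
  assumes "left_continuous_tnorm T"
    and "u \<in> {0..1}" "v \<in> {0..1}" "0 \<le> a" "a < T u v"
  obtains u' v' where "0 \<le> u'" "u' < u" "0 \<le> v'" "v' < v" "a < T u' v'"
proof -
  obtain u' where u': "0 \<le> u'" "u' < u" "a < T u' v"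
    using tnorm_left_approx[OF T assms] by blast
  then have "u' \<in> {0..1}" "a < T v u'"
    using assms(2,3) tnorm_commute[of u' v] by auto
  then obtain v' where v': "0 \<le> v'" "v' < v" "a < T v' u'"
    using tnorm_left_approx[OF T assms(1,3) _ assms(4)] by blast
  moreover have "T v' u' = T u' v'"
    using v' assms(3) \<open>u' \<in> {0..1}\<close> by (intro tnorm_commute) auto
  ultimately show ?thesis
    using that u' by auto
qed

text \<open>For a monotone operation one-sided approximation in each variable separately is enough: a
  corner \<open>(a', b')\<close> with \<open>T a' b'\<close> on the right side of a level controls the whole quadrant
  below (or above) it. Right continuity in the first variable suffices by commutativity.\<close>

lemma continuous_tnormI:
  assumes left: "left_continuous_tnorm T"
    and right: "\<And>p q a. p \<in> {0..<1} \<Longrightarrow> q \<in> {0..1} \<Longrightarrow> T p q < a \<Longrightarrow>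
      \<exists>p'. p < p' \<and> p' \<le> 1 \<and> T p' q < a"
  shows "continuous_tnorm T"
  unfolding continuous_tnorm_def continuous_on_def
proof (intro ballI)
  fix z :: "real \<times> real" assume "z \<in> {0..1} \<times> {0..1}"
  then obtain a b where z: "z = (a, b)" and ab: "a \<in> {0..1}" "b \<in> {0..1}"
    by blast
  let ?F = "at (a, b) within {0..1} \<times> {0..1::real}"
  have fst: "((\<lambda>z. fst z) \<longlongrightarrow> a) ?F" and snd: "((\<lambda>z. snd z) \<longlongrightarrow> b) ?F"
    using tendsto_fst[OF tendsto_ident_at] tendsto_snd[OF tendsto_ident_at] by fastforce+
  have mem: "eventually (\<lambda>z. z \<in> {0..1} \<times> {0..1}) ?F"
    by (simp add: eventually_at_filter)
  \<comment> \<open>At \<open>p = 1\<close> nothing in the unit interval lies to the right, and \<open>p\<close> itself dominates all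
    nearby points.\<close>
  have above: "\<exists>p'\<in>{0..1}. T p' q < c \<and> (\<exists>u>p. \<forall>t\<le>1. t < u \<longrightarrow> t \<le> p')"
    if "p \<in> {0..1}" "q \<in> {0..1}" "T p q < c" for p q c
  proof (cases "p = 1")
    case True
    then show ?thesis
      using that by (intro bexI[of _ p] conjI exI[of _ 2]) auto
  next
    case False
    with that(1) have "p \<in> {0..<1}"
      by auto
    from right[OF this that(2,3)] obtain p' where "p < p'" "p' \<le> 1" "T p' q < c"
      by blast
    then show ?thesis
      using that by (intro bexI[of _ p'] conjI exI[of _ p']) auto
  qed
  have "((\<lambda>(p, q). T p q) \<longlongrightarrow> T a b) ?F"
  proof (rule order_tendstoI)
    fix c assume c: "c < T a b"
    show "eventually (\<lambda>z. c < (case z of (p, q) \<Rightarrow> T p q)) ?F"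
    proof (cases "c < 0")
      case True
      from mem show ?thesis
        by eventually_elim (use True tnorm_range in \<open>force\<close>)
    next
      case False
      then obtain a' b' where a': "0 \<le> a'" "a' < a" "0 \<le> b'" "b' < b" "c < T a' b'"
        using tnorm_left_approx_both[OF left ab _ c] by auto
      from mem order_tendstoD(1)[OF fst a'(2)] order_tendstoD(1)[OF snd a'(4)] show ?thesis
      proof eventually_elim
        case (elim z)
        then have "T a' b' \<le> T (fst z) (snd z)"
          using a' by (intro tnorm_mono) (auto simp: mem_Times_iff)
        then show ?case
          using a' by (simp add: case_prod_beta)
      qed
    qed
  next
    fix c assume "T a b < c"
    then obtain a' u where a': "a' \<in> {0..1}" "T a' b < c" "a < u" "\<And>t. t \<le> 1 \<Longrightarrow> t < u \<Longrightarrow> t \<le> a'"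
      using above[OF ab] by metis
    then have "T b a' < c"
      using ab tnorm_commute by simp
    then obtain b' v where b': "b' \<in> {0..1}" "T b' a' < c" "b < v" "\<And>t. t \<le> 1 \<Longrightarrow> t < v \<Longrightarrow> t \<le> b'"
      using above[OF ab(2) a'(1)] by metis
    from mem order_tendstoD(2)[OF fst a'(3)] order_tendstoD(2)[OF snd b'(3)]
    show "eventually (\<lambda>z. (case z of (p, q) \<Rightarrow> T p q) < c) ?F"
    proof eventually_elim
      case (elim z)
      then have "T (fst z) (snd z) \<le> T a' b'"
        using a' b' by (intro tnorm_mono) (auto simp: mem_Times_iff)
      then show ?case
        using b' a' tnorm_commute[of a' b'] by (simp add: case_prod_beta)
    qed
  qed
  then show "((\<lambda>(p, q). T p q) \<longlongrightarrow> (case z of (p, q) \<Rightarrow> T p q)) (at z within {0..1} \<times> {0..1})"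
    by (simp add: z)
qed

end

section \<open>Approximation from the right for t-conorms\<close>

context
  fixes L :: "ennreal \<Rightarrow> ennreal \<Rightarrow> ennreal"
  assumes L: "tconorm L"
begin

lemma tconorm_mono: "x \<le> x' \<Longrightarrow> y \<le> y' \<Longrightarrow> L x y \<le> L x' y'"
  using L unfolding tconorm_def by (meson order_trans)

lemma tconorm_zero: "L x 0 = x" "L 0 x = x"
  using L unfolding tconorm_def by blast+

lemma tconorm_commute: "L x y = L y x"
  using L unfolding tconorm_def by blast

lemma tconorm_ge: "x \<le> L x y" "y \<le> L x y"
  using tconorm_mono[of x x 0 y] tconorm_mono[of 0 x y y] by (simp_all add: tconorm_zero)

lemma tconorm_right_approx_both:
  assumes "right_continuous_tconorm L" "L r s < x"
  obtains r' s' where "r < r'" "s < s'" "L r' s' < x"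
proof -
  obtain r' where r': "r < r'" "L r' s < x"
    using tconorm_right_approx[OF L assms] by blast
  then have "L s r' < x"
    by (simp add: tconorm_commute)
  then obtain s' where "s < s'" "L s' r' < x"
    using tconorm_right_approx[OF L assms(1)] by blast
  then show ?thesis
    using that r' by (simp add: tconorm_commute)
qed

end

section \<open>Necessity of continuity and of (LS)\<close>

text \<open>With \<open>f = ramp p 1 1\<close> and \<open>g = ramp q 2 1\<close> the tensor at \<open>x \<le> 2\<close> sees only the value
  \<open>q\<close> of \<open>g\<close>, hence behaves like \<open>T (f x) q\<close>. Since \<open>f\<close> leaves the level \<open>p\<close> strictly
  upwards at 1, right continuity of the tensor at 1 is right continuity of \<open>T\<close> in its first
  variable at \<open>(p, q)\<close>.\<close>

lemma closed_imp_continuous_tnorm: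
  assumes T: "tnorm T" "left_continuous_tnorm T"
    and L: "tconorm L" "right_continuous_tconorm L"
    and closed: "\<And>f g. f \<in> cont_ddf \<Longrightarrow> g \<in> cont_ddf \<Longrightarrow> ddf_tensor L T f g \<in> cont_ddf"
  shows "continuous_tnorm T"
proof (rule continuous_tnormI[OF T])
  fix p q a :: real assume p: "p \<in> {0..<1}" and q: "q \<in> {0..1}" and a: "T p q < a"
  let ?f = "ramp p 1 1" and ?g = "ramp q 2 1"
  let ?h = "ddf_tensor L T ?f ?g"
  have f: "?f \<in> cont_ddf" and g: "?g \<in> cont_ddf"
    using p q by (auto intro!: ramp_mem_cont_ddf simp: less_top[symmetric])
  then have ddf: "?f \<in> ddf" "?g \<in> ddf" and h: "?h \<in> cont_ddf" "?h \<in> ddf"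
    using closed[OF f g] by (auto simp: cont_ddf_def)
  note iff = less_tensor_iff[OF T(1) L(1) ddf]
  have range: "?f r \<in> {0..1}" "?g r \<in> {0..1}" for r
    using ddf by (auto simp: ddf_def)
  have one_less_two: "(1::ennreal) < 2"
    by simp
  have "?h 1 \<le> T p q"
  proof (rule ccontr)
    assume "\<not> ?h 1 \<le> T p q"
    then obtain r s where rs: "L r s < 1" "T p q < T (?f r) (?g s)"
      using iff[of 1 "T p q"] tnorm_range[OF T(1), of p q] p q by auto
    have "r \<le> 1" "s \<le> 2"
      using tconorm_ge[OF L(1), of r s] tconorm_ge[OF L(1), of s r] rs(1) one_less_two
      by (meson le_less_trans less_imp_le less_trans tconorm_ge[OF L(1)])+
    then have "?f r \<le> p" "?g s \<le> q"
      using p q by (auto intro!: ramp_le simp: less_top[symmetric])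
    then have "T (?f r) (?g s) \<le> T p q"
      using range[of r] range[of s] p q by (intro tnorm_mono[OF T(1)]) auto
    then show False
      using rs by simp
  qed
  then obtain y where y: "1 < y" "?h y < a"
    using h a unfolding cont_ddf_iff[OF h(2)] by (force simp: less_top[symmetric])
  \<comment> \<open>The argument of \<open>g\<close> has to be a positive \<open>s\<close>, since \<open>g 0 = 0\<close>; right continuity of
    \<open>L\<close> at \<open>(0, y')\<close> provides one.\<close>
  obtain y' where y': "1 < y'" "y' < min y 2"
    using dense[of 1 "min y 2"] y one_less_two by auto
  then have "L y' 0 < min y 2"
    using tconorm_zero[OF L(1)] by simp
  then have "L 0 y' < min y 2"
    using tconorm_commute[OF L(1)] by simp
  then obtain s where s: "0 < s" "L s y' < min y 2"
    using tconorm_right_approx[OF L] by blast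
  have ys: "L y' s < min y 2"
    using s tconorm_commute[OF L(1)] by simp
  have "s \<le> 2"
    using tconorm_ge(1)[OF L(1), of s y'] s(2) by auto
  then have gs: "?g s = q"
    using s(1) by (intro ramp_before) auto
  have step: "step_ddf (L y' s) (T (?f y') (?g s)) y \<le> ?h y"
    by (rule tensor_upper[OF T(1) L(1) ddf])
  have "T (?f y') q \<le> ?h y"
  proof (cases "y = \<infinity>")
    case True
    then show ?thesis
      using h(2) tnorm_range[OF T(1) range(1)[of y'] q] by (auto simp: ddf_def)
  next
    case False
    then show ?thesis
      using step ys gs by (simp add: step_ddf_def)
  qed
  then have "T (?f y') q < a"
    using y by simp
  moreover have "p < ?f y'"
    using p y' by (intro ramp_greater) (auto simp: less_top[symmetric])
  ultimately show "\<exists>p'. p < p' \<and> p' \<le> 1 \<and> T p' q < a"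
    using range(1)[of y'] by auto
qed

text \<open>If \<open>L\<close> takes the same value \<open>z\<close> at \<open>(x, y)\<close> and at a strictly larger point, the tensor
  of ramps that rise between the two is 0 up to \<open>z\<close> (a positive value of both ramps forces
  \<open>L r s \<ge> z\<close>) and 1 beyond \<open>z\<close>. This is a jump at \<open>z\<close> when \<open>z\<close> is finite, and a mass
  at infinity otherwise.\<close>

lemma closed_imp_LS_condition:
  assumes T: "tnorm T" and L: "tconorm L"
    and closed: "\<And>f g. f \<in> cont_ddf \<Longrightarrow> g \<in> cont_ddf \<Longrightarrow> ddf_tensor L T f g \<in> cont_ddf"
  shows "LS_condition L"
  unfolding LS_condition_def
proof (intro allI impI)
  fix x x' y y' :: ennreal assume "x < x' \<and> y < y'"
  \<comment> \<open>Intermediate points are used because \<open>x'\<close> and \<open>y'\<close> may be infinite, whereas the ramps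
    need a finite length.\<close>
  then obtain x'' y'' where xy: "x < x''" "x'' < x'" "y < y''" "y'' < y'"
    using dense by meson
  show "L x y < L x' y'"
  proof (rule ccontr)
    assume "\<not> L x y < L x' y'"
    moreover have "L x'' y'' \<le> L x' y'" "L x y \<le> L x'' y''"
      using xy by (auto intro!: tconorm_mono[OF L])
    ultimately have eq: "L x'' y'' = L x y"
      by auto
    define z where "z = L x y"
    let ?f = "ramp 0 x (x'' - x)" and ?g = "ramp 0 y (y'' - y)"
    let ?h = "ddf_tensor L T ?f ?g"
    have fin: "x'' < \<infinity>" "y'' < \<infinity>" "x < \<infinity>" "y < \<infinity>"
      using xy by (auto intro: less_le_trans less_trans simp: less_top[symmetric] top_unique)
    have d: "0 < x'' - x" "x'' - x < \<infinity>" "0 < y'' - y" "y'' - y < \<infinity>"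
      using xy fin by (auto simp: diff_gr0_ennreal diff_less_top_ennreal)
    have f: "?f \<in> cont_ddf" and g: "?g \<in> cont_ddf"
      using d fin by (auto intro!: ramp_mem_cont_ddf)
    then have ddf: "?f \<in> ddf" "?g \<in> ddf" and h: "?h \<in> cont_ddf" "?h \<in> ddf"
      using closed[OF f g] by (auto simp: cont_ddf_def)
    note iff = less_tensor_iff[OF T L ddf]
    have range: "?f r \<in> {0..1}" "?g r \<in> {0..1}" for r
      using ddf by (auto simp: ddf_def)
    have below: "?h t \<le> 0" if t: "t \<le> z" "t < \<infinity>" for t
    proof (rule ccontr)
      assume "\<not> ?h t \<le> 0"
      then obtain r s where rs: "L r s < t" "0 < T (?f r) (?g s)"
        using iff[OF t(2), of 0] by auto
      then have "r \<le> x \<or> s \<le> y"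
        using t(1) tconorm_mono[OF L, of x r y s] unfolding z_def
        by (meson leD le_less_trans less_imp_le not_le order_trans)
      then have "?f r \<le> 0 \<or> ?g s \<le> 0"
        using fin by (auto intro: ramp_le)
      then show False
        using rs(2) range[of r] range[of s] tnorm_zero[OF T]
        by (metis atLeastAtMost_iff order_antisym less_irrefl)
    qed
    show False
    proof (cases "z = \<infinity>")
      case True
      obtain t where "t < \<infinity>" "0 < ?h t"
        using h(1) zero_less_one[where ?'a = real] unfolding cont_ddf_iff[OF h(2)] by blast
      then show False
        using below[of t] True by auto
    next
      case False
      have "0 < z"
        using tconorm_ge(1)[OF L, of x'' y''] xy eq unfolding z_def
        by (auto intro: less_le_trans[of 0 x''] le_less_trans[of 0 x])
      then obtain t where t: "z < t" "?h t < 1"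
        using h(1) below[of z] False unfolding cont_ddf_iff[OF h(2)] by (force simp: less_top)
      have "?f x'' = 1" "?g y'' = 1"
        using d fin xy by (auto intro!: ramp_after simp: add_diff_eq_ennreal less_imp_le)
      then have "T (?f x'') (?g y'') = 1"
        using tnorm_one[OF T, of 1] by simp
      then have "1 \<le> ?h t"
        using tensor_upper[OF T L ddf, of x'' y'' t] t(1) eq unfolding z_def
        by (simp add: step_ddf_def split: if_splits)
      then show False
        using t by simp
    qed
  qed
qed

section \<open>Sufficiency by compactness\<close>

text \<open>This is where (LS) compensates for \<open>L\<close> not being left continuous: a point strictly below the
  limit in both coordinates has a second such point in between, whose \<open>L\<close>-value is strictly
  larger yet still bounded by \<open>x\<close>. At a zero coordinate there is nothing strictly below, and the
  coordinate 0 itself is admitted; there \<open>L\<close> is known since 0 is its identity.\<close>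

lemma LS_limit_less:
  assumes L: "tconorm L" "right_continuous_tconorm L" and LS: "LS_condition L"
    and lim: "r \<longlonglongrightarrow> r0" "s \<longlonglongrightarrow> s0" "y \<longlonglongrightarrow> x"
    and less: "\<And>n. L (r n) (s n) < y n" and x: "0 < x"
    and r': "r' < r0 \<or> r' = 0 \<and> r0 = 0" and s': "s' < s0 \<or> s' = 0 \<and> s0 = 0"
  shows "L r' s' < x"
proof -
  have "r0 \<le> x" "s0 \<le> x"
    using tconorm_ge[OF L(1)] less
    by (auto intro!: LIMSEQ_le[OF lim(1,3)] LIMSEQ_le[OF lim(2,3)]) (meson le_less_trans less_imp_le)+
  show ?thesis
  proof (cases "r0 = 0 \<or> s0 = 0")
    case True
    then show ?thesis
      using r' s' \<open>r0 \<le> x\<close> \<open>s0 \<le> x\<close> x tconorm_zero[OF L(1)] by (auto intro: less_le_trans)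
  next
    case False
    then obtain r'' s'' where mid: "r' < r''" "r'' < r0" "s' < s''" "s'' < s0"
      using r' s' dense by meson
    have "eventually (\<lambda>n. L r'' s'' \<le> y n) sequentially"
      using order_tendstoD(1)[OF lim(1) mid(2)] order_tendstoD(1)[OF lim(2) mid(4)]
    proof eventually_elim
      case (elim n)
      then have "L r'' s'' \<le> L (r n) (s n)"
        by (intro tconorm_mono[OF L(1)]) auto
      then show ?case
        using less[of n] by auto
    qed
    then have "L r'' s'' \<le> x"
      by (rule tendsto_lowerbound[OF lim(3)]) simp
    moreover have "L r' s' < L r'' s''"
      using LS mid unfolding LS_condition_def by blast
    ultimately show ?thesis
      by simp
  qed
qed

text \<open>At infinity the tensor reaches values near 1 since \<open>T\<close> is left continuous at \<open>(1, 1)\<close> and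
  \<open>L\<close> maps finite arguments to finite values, an instance of (LS) against \<open>(\<infinity>, \<infinity>)\<close>. On the right of a
  finite point a compactness argument with \<open>LS_limit_less\<close> excludes a jump.\<close>

lemma ddf_tensor_mem_cont_ddf:
  assumes T: "tnorm T" "left_continuous_tnorm T" "continuous_tnorm T"
    and L: "tconorm L" "right_continuous_tconorm L" and LS: "LS_condition L"
    and f: "f \<in> cont_ddf" and g: "g \<in> cont_ddf"
  shows "ddf_tensor L T f g \<in> cont_ddf"
proof -
  let ?h = "ddf_tensor L T f g"
  have ddf: "f \<in> ddf" "g \<in> ddf"
    using f g by (auto simp: cont_ddf_def)
  have h: "?h \<in> ddf"
    using ddf_tensor_closed[OF T(1) L(1) ddf] .
  note iff = less_tensor_iff[OF T(1) L(1) ddf]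
  have range: "f r \<in> {0..1}" "g r \<in> {0..1}" for r
    using ddf by (auto simp: ddf_def)
  obtain F where F: "continuous_on UNIV F" "mono F" "\<And>x. F x \<in> {0..1}"
    "\<And>x. 0 < x \<Longrightarrow> F x = f x" "\<And>x. f x \<le> F x"
    using cont_ddf_extension[OF f] by blast
  obtain G where G: "continuous_on UNIV G" "mono G" "\<And>x. G x \<in> {0..1}"
    "\<And>x. 0 < x \<Longrightarrow> G x = g x" "\<And>x. g x \<le> G x"
    using cont_ddf_extension[OF g] by blast
  have approach: "\<exists>r'. (r' < r \<or> r' = 0 \<and> r = 0) \<and> p < H r'"
    if "continuous_on UNIV H" "p < H r" for H :: "ennreal \<Rightarrow> real" and p r
  proof (cases "r = 0")
    case False
    then have r: "0 < r"
      by (simp add: zero_less_iff_neq_zero)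
    have "(H \<longlongrightarrow> H r) (at_left r)"
      using that(1) by (auto simp: continuous_on_def intro: tendsto_within_subset)
    then have "eventually (\<lambda>y. p < H y) (at_left r)"
      using that(2) by (rule order_tendstoD)
    then obtain b where "b < r" "\<And>y. b < y \<Longrightarrow> y < r \<Longrightarrow> p < H y"
      by (auto simp: eventually_at_left[OF r])
    then show ?thesis
      using dense by blast
  qed (use that in auto)
  have at_inf: "\<exists>y<\<infinity>. a < ?h y" if a: "a < 1" for a
  proof -
    have "max a 0 < T 1 1"
      using a tnorm_one[OF T(1), of 1] by simp
    then obtain u v where uv: "0 \<le> u" "u < 1" "0 \<le> v" "v < 1" "max a 0 < T u v"
      using tnorm_left_approx_both[OF T(1,2), of 1 1 "max a 0"] by auto
    obtain r s where rs: "r < \<infinity>" "u < f r" "s < \<infinity>" "v < g s"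
      using f g uv unfolding cont_ddf_iff[OF ddf(1)] cont_ddf_iff[OF ddf(2)] by meson
    have "T u v \<le> T (f r) (g s)"
      using uv rs range[of r] range[of s] by (intro tnorm_mono[OF T(1)]) auto
    moreover have "L r s < L \<infinity> \<infinity>"
      using LS rs unfolding LS_condition_def by blast
    then obtain y where "L r s < y" "y < \<infinity>"
      using dense[of "L r s"] tconorm_ge(1)[OF L(1), of \<infinity> \<infinity>] by (auto simp: top_unique)
    ultimately have "max a 0 < ?h y"
      using iff[of y "max a 0"] uv(5) by (meson less_le_trans max.cobounded2)
    then show ?thesis
      using \<open>y < \<infinity>\<close> by auto
  qed
  have right: "\<exists>y>x. ?h y < a" if x: "0 < x" "x < \<infinity>" and a: "?h x < a" for x a
  proof (rule ccontr)
    assume neg: "\<not> (\<exists>y>x. ?h y < a)"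
    \<comment> \<open>Level \<open>b\<close> survives passage to the limit only as a weak inequality; the gap down to \<open>c\<close>
      restores strictness for the subsequent step to the left.\<close>
    obtain b c where bc: "?h x < c" "c < b" "b < a"
      using a dense by meson
    have nn: "0 \<le> ?h x"
      using tensor_nonneg[OF T(1) L(1) ddf] .
    obtain y where y: "\<And>n. x < y n" "\<And>n. y n < \<infinity>" "y \<longlonglongrightarrow> x"
    proof -
      obtain y where y: "\<And>n. x < y n" "y \<longlonglongrightarrow> x"
        using approx_from_above_dense_linorder[OF x(2)] by blast
      obtain N where N: "\<And>n. n \<ge> N \<Longrightarrow> y n < \<infinity>"
        using order_tendstoD(2)[OF y(2) x(2)] by (auto simp: eventually_sequentially)
      show ?thesis
        by (rule that[of "\<lambda>n. y (n + N)"]) (use y N LIMSEQ_ignore_initial_segment in auto)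
    qed
    have "\<exists>w. L (fst w) (snd w) < y n \<and> b < T (f (fst w)) (g (snd w))" for n
    proof -
      have "b < ?h (y n)"
        using neg y(1)[of n] bc by (meson less_le_trans not_le)
      then show ?thesis
        using iff[OF y(2)[of n], of b] bc nn by auto
    qed
    then obtain w where w: "\<And>n. L (fst (w n)) (snd (w n)) < y n"
        "\<And>n. b < T (f (fst (w n))) (g (snd (w n)))"
      by metis
    have "seq_compact (UNIV \<times> UNIV :: (ennreal \<times> ennreal) set)"
      by (intro compact_imp_seq_compact compact_Times compact_UNIV)
    then obtain z \<phi> where z: "strict_mono \<phi>" "(w \<circ> \<phi>) \<longlonglongrightarrow> z"
      by (auto elim!: seq_compactE[of _ w])
    obtain r0 s0 where z_eq: "z = (r0, s0)"
      by (cases z)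
    have lim: "(\<lambda>n. fst (w (\<phi> n))) \<longlonglongrightarrow> r0" "(\<lambda>n. snd (w (\<phi> n))) \<longlonglongrightarrow> s0"
      using tendsto_fst[OF z(2)] tendsto_snd[OF z(2)] by (auto simp: z_eq)
    have lim_y: "(\<lambda>n. y (\<phi> n)) \<longlonglongrightarrow> x"
      using LIMSEQ_subseq_LIMSEQ[OF y(3) z(1)] by (simp add: comp_def)
    have "b \<le> T (F r0) (G s0)"
    proof (rule LIMSEQ_le_const)
      have "(\<lambda>n. (F (fst (w (\<phi> n))), G (snd (w (\<phi> n))))) \<longlonglongrightarrow> (F r0, G s0)"
        by (intro tendsto_Pair continuous_on_tendsto_compose[OF F(1)]
            continuous_on_tendsto_compose[OF G(1)] lim) auto
      then have "(\<lambda>n. case (F (fst (w (\<phi> n))), G (snd (w (\<phi> n)))) of (p, q) \<Rightarrow> T p q)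
          \<longlonglongrightarrow> (case (F r0, G s0) of (p, q) \<Rightarrow> T p q)"
        by (rule continuous_on_tendsto_compose[OF T(3)[unfolded continuous_tnorm_def]])
          (use F(3) G(3) in auto)
      then show "(\<lambda>n. T (F (fst (w (\<phi> n)))) (G (snd (w (\<phi> n))))) \<longlonglongrightarrow> T (F r0) (G s0)"
        by simp
      have "b \<le> T (F (fst (w (\<phi> n)))) (G (snd (w (\<phi> n))))" for n
      proof -
        have "T (f (fst (w (\<phi> n)))) (g (snd (w (\<phi> n)))) \<le> T (F (fst (w (\<phi> n)))) (G (snd (w (\<phi> n))))"
          using range F(3,5) G(3,5) by (intro tnorm_mono[OF T(1)]) auto
        then show ?thesis
          using w(2)[of "\<phi> n"] by simp
      qed
      then show "\<exists>N. \<forall>n\<ge>N. b \<le> T (F (fst (w (\<phi> n)))) (G (snd (w (\<phi> n))))"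
        by blast
    qed
    then have "c < T (F r0) (G s0)"
      using bc by simp
    then obtain p q where pq: "0 \<le> p" "p < F r0" "0 \<le> q" "q < G s0" "c < T p q"
      using tnorm_left_approx_both[OF T(1,2) F(3) G(3)] bc nn by (metis less_imp_le order_trans)
    obtain r' where r': "r' < r0 \<or> r' = 0 \<and> r0 = 0" "p < F r'"
      using approach[OF F(1) pq(2)] by blast
    obtain s' where s': "s' < s0 \<or> s' = 0 \<and> s0 = 0" "q < G s'"
      using approach[OF G(1) pq(4)] by blast
    have "L r' s' < x"
      by (rule LS_limit_less[OF L LS lim lim_y w(1) x(1) r'(1) s'(1)])
    \<comment> \<open>\<open>r'\<close> and \<open>s'\<close> may be 0, where \<open>F\<close> and \<open>G\<close> differ from \<open>f\<close> and \<open>g\<close>, so the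
      arguments are moved back to the right.\<close>
    then obtain r s where rs: "r' < r" "s' < s" "L r s < x"
      using tconorm_right_approx_both[OF L] by blast
    have pos: "0 < r" "0 < s"
      using rs(1,2) by (auto intro: le_less_trans[OF zero_le])
    have "F r' \<le> f r" "G s' \<le> g s"
      using monoD[OF F(2), of r' r] monoD[OF G(2), of s' s] rs pos F(4)[of r] G(4)[of s] by auto
    then have "T p q \<le> T (f r) (g s)"
      using pq r'(2) s'(2) range[of r] range[of s] by (intro tnorm_mono[OF T(1)]) auto
    then have "c < T (f r) (g s)"
      using pq by simp
    then have "c < ?h x"
      using iff[OF x(2), of c] rs(3) bc nn by auto
    then show False
      using bc by simp
  qed
  show ?thesis
    unfolding cont_ddf_iff[OF h] using right at_inf by blast
qed

theorem theorem4p5: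
  fixes T :: "real \<Rightarrow> real \<Rightarrow> real" and L :: "ennreal \<Rightarrow> ennreal \<Rightarrow> ennreal"
  assumes "tnorm T" and "left_continuous_tnorm T"
    and "tconorm L" and "right_continuous_tconorm L"
  shows "((\<forall>f\<in>cont_ddf. \<forall>g\<in>cont_ddf. ddf_tensor L T f g \<in> cont_ddf)
            \<longleftrightarrow> continuous_tnorm T \<and> LS_condition L) \<and>
         (continuous_tnorm T \<and> LS_condition L \<longrightarrow> submonoid cont_ddf (ddf_monoid L T))"
proof (intro conjI iffI impI)
  assume closed: "\<forall>f\<in>cont_ddf. \<forall>g\<in>cont_ddf. ddf_tensor L T f g \<in> cont_ddf"
  show "continuous_tnorm T"
    using closed by (intro closed_imp_continuous_tnorm[OF assms]) auto
  show "LS_condition L"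
    using closed by (intro closed_imp_LS_condition[OF assms(1,3)]) auto
next
  assume *: "continuous_tnorm T \<and> LS_condition L"
  then show closed: "\<forall>f\<in>cont_ddf. \<forall>g\<in>cont_ddf. ddf_tensor L T f g \<in> cont_ddf"
    using ddf_tensor_mem_cont_ddf[OF assms(1,2) _ assms(3,4)] by blast
  then show "submonoid cont_ddf (ddf_monoid L T)"
    using one_mem_cont_ddf by (auto simp: submonoid_def ddf_monoid_def cont_ddf_def)
qed

end
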